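(* For each $k\in\mathbb N$, there exists a closed PGA term $P$ for which there does not exist a closed $\mathrm{PGA}_g^k$ term $P'$ such that $|P| = |\mathsf{pgag2pga}(P')|$.
   Context: Threads. Fix an arbitrary set $\mathfrak A$ of basic instructions, also used as basic actions. Basic thread algebra (BTA) has constants $\mathsf D$ (deadlock), $\mathsf S$ (termination) and, for each $a\in\mathfrak A$, a binary operator $x\unlhd a\unrhd y$ (perform $a$; proceed as $x$ on reply $\mathsf T$, as $y$ on reply $\mathsf F$); $a\circ p$ abbreviates $p\unlhd a\unrhd p$. Possibly infinite threads are given by guarded recursive specifications (sets of equations $X=t_X$ with $t_X$ equal to $\mathsf D$, $\mathsf S$ or of the form $t\unlhd a\unrhd t'$). Projections: $\pi_0(x)=\mathsf D$, $\pi_{n+1}(\mathsf S)=\mathsf S$, $\pi_{n+1}(\mathsf D)=\mathsf D$, $\pi_{n+1}(x\unlhd a\unrhd y)=\pi_n(x)\unlhd a\unrhd\pi_n(y)$. Approximation induction principle: if $\pi_n(x)=\pi_n(y)$ for all $n\ge0$ then $x=y$. Threads are the elements of a fixed but arbitrary model of BTA with guarded recursion in which guarded recursive specifications have unique solutions and the approximation induction principle holds (such as the projective limit model). Program algebra (PGA). Primitive instructions: $a$, $+a$, $-a$ for $a\in\mathfrak A$; forward jumps $\#l$ for $l\in\mathbb N$; termination $!$. Closed PGA terms are built from primitive instructions by concatenation $X;Y$ and repetition $X^\omega$; they denote non-empty finite or eventually periodic infinite instruction sequences ($X^\omega$ is $X$ repeated forever, and $X^\omega;Y=X^\omega$), and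 terms denoting the same sequence are identified. Thread extraction $|\cdot|$ assigns to each closed PGA term a thread, by: $|a|=|{+a}|=|{-a}|=a\circ\mathsf D$; $|a;X|=a\circ|X|$; $|{+a};X|=|X|\unlhd a\unrhd|\#2;X|$; $|{-a};X|=|\#2;X|\unlhd a\unrhd|X|$; $|\#l|=\mathsf D$; $|\#0;X|=\mathsf D$; $|\#1;X|=|X|$; $|\#(l+2);u|=\mathsf D$; $|\#(l+2);u;X|=|\#(l+1);X|$ ($u$ a primitive instruction); $|!|=|!;X|=\mathsf S$; and $|\#l;X|=\mathsf D$ if $\#l$ begins an infinite chain of jumps. For sequences with repetition these equations yield a finite guarded recursive specification, whose solution is the extracted thread. $\mathrm{PGA}_g$. The variant of PGA with the same operators, but with primitive instructions $a$, $+a$, $-a$ ($a\in\mathfrak A$), label instructions $\mathsf{lbl}(l)$ and goto instructions $\mathsf{goto}(l)$ for $l\in\mathbb N$, and $!$ (no jumps). Every closed $\mathrm{PGA}_g$ term equals one of the form $u_1;\ldots;u_n$ or $u_1;\ldots;u_n;(u_{n+1};\ldots;u_m)^\omega$ with all $u_j$ primitive. The function $\mathsf{pgag2pga}$ from closed $\mathrm{PGA}_g$ terms to closed PGA terms is defined by $\mathsf{pgag2pga}(u_1;\ldots;u_n)=\mathsf{pgag2pga}(u_1;\ldots;u_n;(\mathsf{goto}(1))^\omega)$ and $\mathsf{pgag2pga}(u_1;\ldots;u_n;(u_{n+1};\ldots;u_m)^\omega)=\phi_1(u_1);\ldots;\phi_n(u_n);(\phi_{n+1}(u_{n+1});\ldots;\phi_m(u_m))^\omega$,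 where $\phi_j(\mathsf{lbl}(l))=\#1$, $\phi_j(\mathsf{goto}(l))=\#\mathit{tgt}_j(l)$, and $\phi_j(u)=u$ for other $u$. Here $\mathit{tgt}_j(l)=i$ if the leftmost occurrence of $\mathsf{lbl}(l)$ in $u_j;\ldots;u_m;u_{n+1};\ldots;u_m$ is its $i$-th instruction, and $\mathit{tgt}_j(l)=0$ if there is no such occurrence. A $\mathrm{PGA}_g^k$ term is a $\mathrm{PGA}_g$ term containing no label instruction $\mathsf{lbl}(l)$ with $l>k$; its label instructions $\mathsf{lbl}(l)$ are taken to satisfy $1\le l\le k$ (goto instructions are not restricted).
   Formalization: The set of basic instructions is taken to be non-empty, and the model is required not to identify distinct closed BTA terms; for an empty set, or in the one-element model, the claim is false. *)

theory Defs
  imports Main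
begin

section \<open>Threads\<close>

datatype (vars: 'v, 'a) bta_term =
    Var 'v
  | Dead
  | Stop
  | Post "('v, 'a) bta_term" 'a "('v, 'a) bta_term"

fun guarded :: "('v, 'a) bta_term \<Rightarrow> bool" where
  "guarded (Var X) = False"
| "guarded t = True"

record ('a, 't) bta_algebra =
  dead :: 't
  stop :: 't
  post :: "'t \<Rightarrow> 'a \<Rightarrow> 't \<Rightarrow> 't"
  proj :: "nat \<Rightarrow> 't \<Rightarrow> 't"

primrec eval_bta :: "('a, 't) bta_algebra \<Rightarrow> ('v \<Rightarrow> 't) \<Rightarrow> ('v, 'a) bta_term \<Rightarrow> 't" where
  "eval_bta M \<rho> (Var X) = \<rho> X"
| "eval_bta M \<rho> Dead = dead M"
| "eval_bta M \<rho> Stop = stop M"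
| "eval_bta M \<rho> (Post s a t) = post M (eval_bta M \<rho> s) a (eval_bta M \<rho> t)"

text \<open>
  The carrier of a model is the type \<open>'t\<close>, the set of basic instructions the type \<open>'a\<close>.
  BTA has no equational axioms, so distinct closed terms are not derivably equal; axiom
  \<open>closed_inj\<close> requires that the model does not identify them either. It excludes degenerate
  algebras, such as the one-element algebra, which satisfy all the other axioms.
  A recursive specification is a function from variables to right-hand sides; one with fewer
  variables is padded with equations \<open>X = Dead\<close>.
\<close>

locale thread_model =
  fixes M :: "('a, 't) bta_algebra"
  assumes closed_inj:
      "\<And>(s :: (nat, 'a) bta_term) t \<rho>. vars s = {} \<Longrightarrow> vars t = {} \<Longrightarrow>
         eval_bta M \<rho> s = eval_bta M \<rho> t \<Longrightarrow> s = t"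
    and proj_0: "\<And>x. proj M 0 x = dead M"
    and proj_stop: "\<And>n. proj M (Suc n) (stop M) = stop M"
    and proj_dead: "\<And>n. proj M (Suc n) (dead M) = dead M"
    and proj_post: "\<And>n x a y. proj M (Suc n) (post M x a y) = post M (proj M n x) a (proj M n y)"
    and approximation_induction: "\<And>x y. (\<And>n. proj M n x = proj M n y) \<Longrightarrow> x = y"
    and unique_solution:
      "\<And>E :: nat \<Rightarrow> (nat, 'a) bta_term. (\<And>X. guarded (E X)) \<Longrightarrow>
         \<exists>!\<rho>. \<forall>X. \<rho> X = eval_bta M \<rho> (E X)"


section \<open>Closed terms and the instruction sequences they denote\<close>

text \<open>The type parameter \<open>'u\<close> is the type of primitive instructions.\<close>

datatype (prims: 'u) pterm =
    Prim 'u
  | Cat "'u pterm" "'u pterm"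
  | Rep "'u pterm"

text \<open>
  Canonical forms: \<open>(us, [])\<close> stands for the finite sequence \<open>us\<close>, and \<open>(us, vs)\<close> with
  \<open>vs \<noteq> []\<close> for \<open>us\<close> followed by \<open>vs\<close> repeated forever.
\<close>

fun canonical :: "'u pterm \<Rightarrow> 'u list \<times> 'u list" where
  "canonical (Prim u) = ([u], [])"
| "canonical (Cat P Q) =
     (case canonical P of (us, vs) \<Rightarrow>
        if vs = [] then (case canonical Q of (us', vs') \<Rightarrow> (us @ us', vs')) else (us, vs))"
| "canonical (Rep P) =
     (case canonical P of (us, vs) \<Rightarrow> if vs = [] then ([], us) else (us, vs))"

text \<open>Positions are counted from 0; \<open>None\<close> marks the positions after the end.\<close>

definition iseq :: "'u pterm \<Rightarrow> nat \<Rightarrow> 'u option" where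
  "iseq P i =
     (case canonical P of (us, vs) \<Rightarrow>
        if i < length us then Some (us ! i)
        else if vs = [] then None
        else Some (vs ! ((i - length us) mod length vs)))"

definition pterm_of_list :: "'u list \<Rightarrow> 'u pterm" where
  "pterm_of_list us = foldr (\<lambda>u. Cat (Prim u)) (butlast us) (Prim (last us))"

definition pterm_of_lasso :: "'u list \<Rightarrow> 'u list \<Rightarrow> 'u pterm" where
  "pterm_of_lasso us vs = foldr (\<lambda>u. Cat (Prim u)) us (Rep (pterm_of_list vs))"


section \<open>PGA and thread extraction\<close>

datatype 'a pga_instr = Basic 'a | PosTest 'a | NegTest 'a | Jump nat | Halt

text \<open>Following the chain of jumps from position \<open>i\<close> ends at the non-jump position \<open>j\<close>.\<close>

inductive lands :: "(nat \<Rightarrow> 'a pga_instr option) \<Rightarrow> nat \<Rightarrow> nat \<Rightarrow> bool"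
  for s :: "nat \<Rightarrow> 'a pga_instr option" where
  stay: "s i = Some u \<Longrightarrow> (\<And>l. u \<noteq> Jump l) \<Longrightarrow> lands s i i"
| jump: "s i = Some (Jump l) \<Longrightarrow> lands s (i + l) j \<Longrightarrow> lands s i j"

text \<open>
  The guarded recursive specification obtained from the thread extraction equations: variable
  \<open>i\<close> stands for the thread extracted from the part of the sequence starting at position \<open>i\<close>,
  and chains of jumps are contracted. A chain that is infinite or leaves the sequence yields
  deadlock. That the solution satisfies the usual extraction equations is proved below.
\<close>

definition extraction_spec :: "(nat \<Rightarrow> 'a pga_instr option) \<Rightarrow> nat \<Rightarrow> (nat, 'a) bta_term" where
  "extraction_spec s i =
     (if \<exists>j. lands s i j then
        (let j = (THE j. lands s i j) in
         case s j of
           Some (Basic a) \<Rightarrow> Post (Var (j + 1)) a (Var (j + 1))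
         | Some (PosTest a) \<Rightarrow> Post (Var (j + 1)) a (Var (j + 2))
         | Some (NegTest a) \<Rightarrow> Post (Var (j + 2)) a (Var (j + 1))
         | Some Halt \<Rightarrow> Stop
         | _ \<Rightarrow> Dead)
      else Dead)"

definition residual ::
  "('a, 't) bta_algebra \<Rightarrow> (nat \<Rightarrow> 'a pga_instr option) \<Rightarrow> nat \<Rightarrow> 't" where
  "residual M s = (THE \<rho>. \<forall>i. \<rho> i = eval_bta M \<rho> (extraction_spec s i))"

definition thread_of :: "('a, 't) bta_algebra \<Rightarrow> 'a pga_instr pterm \<Rightarrow> 't" where
  "thread_of M P = residual M (iseq P) 0"


section \<open>PGA with labels and gotos\<close>

datatype 'a pgag_instr =
  GBasic 'a | GPosTest 'a | GNegTest 'a | Label nat | Goto nat | GHalt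

definition tgt :: "'a pgag_instr list \<Rightarrow> nat \<Rightarrow> nat" where
  "tgt ws l =
     (if Label l \<in> set ws then Suc (length (takeWhile (\<lambda>w. w \<noteq> Label l) ws)) else 0)"

fun phi :: "'a pgag_instr list \<Rightarrow> 'a pgag_instr \<Rightarrow> 'a pga_instr" where
  "phi ws (GBasic a) = Basic a"
| "phi ws (GPosTest a) = PosTest a"
| "phi ws (GNegTest a) = NegTest a"
| "phi ws (Label l) = Jump 1"
| "phi ws (Goto l) = Jump (tgt ws l)"
| "phi ws GHalt = Halt"

definition pgag2pga :: "'a pgag_instr pterm \<Rightarrow> 'a pga_instr pterm" where
  "pgag2pga P =
     (let us = fst (canonical P);
          vs = (if snd (canonical P) = [] then [Goto 1] else snd (canonical P));
          ws = us @ vs;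
          qs = map (\<lambda>j. phi (drop j ws @ vs) (ws ! j)) [0..<length ws]
      in pterm_of_lasso (take (length us) qs) (drop (length us) qs))"

definition pgag_k :: "nat \<Rightarrow> 'a pgag_instr pterm \<Rightarrow> bool" where
  "pgag_k k P \<longleftrightarrow> (\<forall>l. Label l \<in> prims P \<longrightarrow> 1 \<le> l \<and> l \<le> k)"


text \<open>
  A sequence may have several canonical forms. The translation does not depend on the choice:
  position \<open>i\<close> of the result depends only on the denoted sequence \<open>g\<close> (a finite one being
  continued with \<open>Goto 1\<close> forever).
\<close>

definition first_label :: "(nat \<Rightarrow> 'a pgag_instr) \<Rightarrow> nat \<Rightarrow> nat \<Rightarrow> nat" where
  "first_label g i l =
     (if \<exists>d. g (i + d) = Label l then Suc (LEAST d. g (i + d) = Label l) else 0)"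

fun translate :: "(nat \<Rightarrow> nat) \<Rightarrow> 'a pgag_instr \<Rightarrow> 'a pga_instr" where
  "translate f (GBasic a) = Basic a"
| "translate f (GPosTest a) = PosTest a"
| "translate f (GNegTest a) = NegTest a"
| "translate f (Label l) = Jump 1"
| "translate f (Goto l) = Jump (f l)"
| "translate f GHalt = Halt"

definition lasso_nth :: "'u list \<Rightarrow> 'u list \<Rightarrow> nat \<Rightarrow> 'u" where
  "lasso_nth us vs i = (if i < length us then us ! i else vs ! ((i - length us) mod length vs))"

lemma phi_translate: "phi ws u = translate (tgt ws) u"
  by (cases u) auto

lemma lasso_nth_unroll:
  assumes "vs \<noteq> []" "j < length (us @ vs)" "d < length (drop j (us @ vs) @ vs)"
  shows "(drop j (us @ vs) @ vs) ! d = lasso_nth us vs (j + d)"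
proof (cases "j + d < length (us @ vs)")
  case True
  then have "(drop j (us @ vs) @ vs) ! d = (us @ vs) ! (j + d)"
  proof -
    have "d < length (drop j (us @ vs))" using True by simp
    then show ?thesis using assms by (simp only: nth_append if_True nth_drop less_imp_le)
  qed
  then show ?thesis using True by (auto simp: nth_append lasso_nth_def)
next
  case False
  define e where "e = j + d - length (us @ vs)"
  have e: "j + d = length us + length vs + e" "e < length vs"
    using False assms by (auto simp: e_def)
  have "(drop j (us @ vs) @ vs) ! d = vs ! e"
  proof -
    have "\<not> d < length (drop j (us @ vs))" using False by simp
    moreover have "d - length (drop j (us @ vs)) = e" using assms(2) False by (simp add: e_def)
    ultimately show ?thesis by (simp only: nth_append[of "drop j (us @ vs)"] if_False)
  qed
  then show ?thesis using e by (simp add: lasso_nth_def)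
qed

lemma tgt_first_label:
  assumes "vs \<noteq> []" "j < length (us @ vs)"
  shows "tgt (drop j (us @ vs) @ vs) l = first_label (lasso_nth us vs) j l"
proof -
  define xs where "xs = drop j (us @ vs) @ vs"
  define g where "g = lasso_nth us vs"
  have xs: "xs ! d = g (j + d)" if "d < length xs" for d
    using lasso_nth_unroll[OF assms] that by (simp add: xs_def g_def)
  have sub: "Label l \<in> set xs" if "g (j + d) = Label l" for d
  proof (cases "j + d < length us")
    case True
    then have "d < length xs" by (simp add: xs_def)
    then show ?thesis using xs that by (metis nth_mem)
  next
    case False
    then have "g (j + d) \<in> set vs" using assms(1) by (simp add: g_def lasso_nth_def)
    then show ?thesis using that by (simp add: xs_def)
  qed
  show ?thesis
  proof (cases "Label l \<in> set xs")
    case True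
    define d where "d = length (takeWhile (\<lambda>w. w \<noteq> Label l) xs)"
    have d: "d < length xs"
     
    proof (rule ccontr)
      assume "\<not> ?thesis"
      then have "length (takeWhile (\<lambda>w. w \<noteq> Label l) xs) = length xs"
        unfolding d_def using length_takeWhile_le[of "\<lambda>w. w \<noteq> Label l" xs] by linarith
      then have "takeWhile (\<lambda>w. w \<noteq> Label l) xs = xs"
        using takeWhile_eq_take[of "\<lambda>w. w \<noteq> Label l" xs] by simp
      then show False using True unfolding takeWhile_eq_all_conv by blast
    qed
    then have "xs ! d = Label l" unfolding d_def using nth_length_takeWhile by blast
    then have gd: "g (j + d) = Label l" using xs d by simp
    have "(LEAST d. g (j + d) = Label l) = d"
    proof (rule Least_equality, rule gd, rule ccontr)
      fix e
      assume e: "g (j + e) = Label l" "\<not> d \<le> e"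
      then have "xs ! e = Label l" using xs d by simp
      moreover have "xs ! e \<in> set (takeWhile (\<lambda>w. w \<noteq> Label l) xs)"
        using e(2) nth_mem[of e "takeWhile (\<lambda>w. w \<noteq> Label l) xs"]
          takeWhile_nth[of e "\<lambda>w. w \<noteq> Label l" xs]
        unfolding d_def by simp
      ultimately show False using set_takeWhileD[of "xs ! e" "\<lambda>w. w \<noteq> Label l" xs] by simp
    qed
    then show ?thesis
      using True gd unfolding tgt_def first_label_def xs_def[symmetric] g_def[symmetric] d_def
      by auto
  next
    case False
    then show ?thesis
      using sub unfolding tgt_def first_label_def xs_def[symmetric] g_def[symmetric] by auto
  qed
qed

lemma canonical_pterm_of_lasso: "vs \<noteq> [] \<Longrightarrow> canonical (pterm_of_lasso us vs) = (us, vs)"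
proof -
  assume "vs \<noteq> []"
  have "canonical (foldr (\<lambda>u. Cat (Prim u)) xs P) = (xs @ fst (canonical P), snd (canonical P))"
    for xs :: "'a list" and P
    by (induction xs) (auto split: prod.split)
  with \<open>vs \<noteq> []\<close> show ?thesis by (simp add: pterm_of_lasso_def pterm_of_list_def)
qed

lemma iseq_pgag2pga:
  fixes P :: "'a pgag_instr pterm"
  defines "g \<equiv> \<lambda>i. case iseq P i of Some u \<Rightarrow> u | None \<Rightarrow> Goto 1"
  shows "iseq (pgag2pga P) i = Some (translate (first_label g i) (g i))"
proof -
  define us where "us = fst (canonical P)"
  define vs where "vs = (if snd (canonical P) = [] then [Goto 1] else snd (canonical P))"
  define qs where
    "qs = map (\<lambda>j. phi (drop j (us @ vs) @ vs) ((us @ vs) ! j)) [0..<length (us @ vs)]"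
  have vs: "vs \<noteq> []" by (simp add: vs_def)
  have g: "g = lasso_nth us vs"
    by (auto simp: fun_eq_iff g_def lasso_nth_def us_def vs_def iseq_def split: prod.split)
  have len: "length qs = length us + length vs" by (simp add: qs_def)
  have "pgag2pga P = pterm_of_lasso (take (length us) qs) (drop (length us) qs)"
    by (simp add: pgag2pga_def Let_def us_def vs_def qs_def)
  moreover have "drop (length us) qs \<noteq> []" using len vs by simp
  ultimately have can: "canonical (pgag2pga P) = (take (length us) qs, drop (length us) qs)"
    by (simp add: canonical_pterm_of_lasso)
  define r where "r = (if i < length us then i else length us + (i - length us) mod length vs)"
  have r: "r < length (us @ vs)" using vs by (auto simp: r_def)
  have "iseq (pgag2pga P) i = Some (qs ! r)"
    using len vs by (auto simp: iseq_def can r_def min_def)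
  also have "qs ! r = translate (tgt (drop r (us @ vs) @ vs)) ((us @ vs) ! r)"
    unfolding qs_def using r by (simp add: phi_translate del: drop_append upt_Suc)
  also have "tgt (drop r (us @ vs) @ vs) = first_label g r"
    using tgt_first_label[OF vs r] by (auto simp: g)
  also have "(us @ vs) ! r = g r"
    using r by (auto simp: g lasso_nth_def nth_append)
  also have shift: "g (r + d) = g (i + d)" for d
  proof (cases "i < length us")
    case False
    then have "((i - length us) mod length vs + d) mod length vs = (i + d - length us) mod length vs"
      by (simp add: mod_add_left_eq)
    then show ?thesis using False by (simp add: g lasso_nth_def r_def add.assoc)
  qed (simp add: r_def)
  from shift have "first_label g r = first_label g i" by (simp add: first_label_def fun_eq_iff)
  also have "g r = g i" using shift[of 0] by simp
  finally show ?thesis .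
qed

lemma pgag2pga_well_defined: "iseq P = iseq Q \<Longrightarrow> iseq (pgag2pga P) = iseq (pgag2pga Q)"
  by (simp add: fun_eq_iff iseq_pgag2pga)


section \<open>The extraction equations\<close>

lemma lands_jump: "s i = Some (Jump l) \<Longrightarrow> lands s i j \<longleftrightarrow> lands s (i + l) j"
  by (auto intro: lands.jump elim: lands.cases)

lemma lands_nonjump:
  assumes "s i = Some u" "\<And>l. u \<noteq> Jump l"
  shows "lands s i j \<longleftrightarrow> j = i"
proof
  assume "lands s i j"
  then show "j = i" using assms by cases auto
next
  assume "j = i"
  then show "lands s i j" using assms by (auto intro: lands.stay)
qed

lemma lands_det: "lands s i j \<Longrightarrow> lands s i j' \<Longrightarrow> j = j'"
proof (induction rule: lands.induct)
  case (stay i u)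
  then show ?case using lands_nonjump[of s i u j'] by blast
next
  case (jump i l j)
  then show ?case by (simp add: lands_jump)
qed

lemma lands_None: "s i = None \<Longrightarrow> \<not> lands s i j"
  by (auto elim: lands.cases)

lemma lands_shiftI: "lands s i j \<Longrightarrow> s = (\<lambda>i. s' (i + d)) \<Longrightarrow> lands s' (i + d) (j + d)"
proof (induction rule: lands.induct)
  case (stay i u)
  then show ?case by (auto intro: lands.stay)
next
  case (jump i l j)
  then have "lands s' (i + d + l) (j + d)" by (simp add: algebra_simps)
  with jump show ?case by (auto intro: lands.jump)
qed

lemma lands_shiftD:
  "lands s' i' j' \<Longrightarrow> i' = i + d \<Longrightarrow> \<exists>j. j' = j + d \<and> lands (\<lambda>i. s' (i + d)) i j"
proof (induction arbitrary: i rule: lands.induct)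
  case (stay i' u)
  then have "lands (\<lambda>i. s' (i + d)) i i" by (intro lands.stay[where u = u]) auto
  then show ?case using stay by auto
next
  case (jump i' l j')
  have "i' + l = (i + l) + d" using jump.prems by simp
  then obtain j where "j' = j + d" "lands (\<lambda>i. s' (i + d)) (i + l) j"
    using jump.IH by blast
  then show ?case using jump.hyps(1) jump.prems by (auto intro: lands.jump)
qed

lemma no_landing:
  assumes "\<And>n. \<exists>l. s (c n) = Some (Jump l) \<and> c (Suc n) = c n + l"
  shows "\<not> lands s (c n) j"
proof -
  have "lands s i j \<Longrightarrow> i = c n \<Longrightarrow> False" for i
  proof (induction arbitrary: n rule: lands.induct)
    case (stay i u)
    then show ?case using assms[of n] by auto
  next
    case (jump i l j)
    then show ?case using assms[of n] jump.IH[of "Suc n"] by auto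
  qed
  then show ?thesis by blast
qed

lemma spec_landing:
  "lands s i j \<Longrightarrow> extraction_spec s i =
     (case s j of
        Some (Basic a) \<Rightarrow> Post (Var (j + 1)) a (Var (j + 1))
      | Some (PosTest a) \<Rightarrow> Post (Var (j + 1)) a (Var (j + 2))
      | Some (NegTest a) \<Rightarrow> Post (Var (j + 2)) a (Var (j + 1))
      | Some Halt \<Rightarrow> Stop
      | _ \<Rightarrow> Dead)"
proof -
  assume l: "lands s i j"
  then have "(THE j. lands s i j) = j" by (blast intro: lands_det)
  with l show ?thesis by (auto simp: extraction_spec_def)
qed

lemma spec_no_landing: "(\<And>j. \<not> lands s i j) \<Longrightarrow> extraction_spec s i = Dead"
  by (simp add: extraction_spec_def)

lemma guarded_extraction_spec: "guarded (extraction_spec s i)"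
  by (auto simp: extraction_spec_def Let_def split: option.split pga_instr.split)

lemma spec_shift:
  "eval_bta M \<rho> (extraction_spec s (i + d)) =
   eval_bta M (\<lambda>i. \<rho> (i + d)) (extraction_spec (\<lambda>i. s (i + d)) i)"
proof (cases "\<exists>j. lands (\<lambda>i. s (i + d)) i j")
  case True
  then obtain j where j: "lands (\<lambda>i. s (i + d)) i j" by blast
  from lands_shiftI[OF j refl] have "lands s (i + d) (j + d)" .
  from spec_landing[OF this] spec_landing[OF j] show ?thesis
    by (auto split: option.split pga_instr.split)
next
  case False
  then have "\<not> lands s (i + d) j" for j using lands_shiftD by blast
  then show ?thesis using False by (simp add: spec_no_landing)
qed

lemma iseq_Prim: "iseq (Prim u) = (\<lambda>i. if i = 0 then Some u else None)"
  by (auto simp: iseq_def fun_eq_iff)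

lemma iseq_Cat_0: "iseq (Cat (Prim u) X) 0 = Some u"
  by (auto simp: iseq_def split: prod.split)

lemma iseq_Cat_Suc: "iseq (Cat (Prim u) X) (Suc i) = iseq X i"
  by (auto simp: iseq_def split: prod.split)

context thread_model
begin

lemma residual_unfold: "residual M s i = eval_bta M (residual M s) (extraction_spec s i)"
proof -
  have "\<exists>!\<rho>. \<forall>i. \<rho> i = eval_bta M \<rho> (extraction_spec s i)"
    by (rule unique_solution) (rule guarded_extraction_spec)
  from theI'[OF this] show ?thesis unfolding residual_def by blast
qed

lemma residual_unique:
  assumes "\<And>i. \<rho> i = eval_bta M \<rho> (extraction_spec s i)"
  shows "residual M s = \<rho>"
proof -
  have "\<exists>!\<rho>. \<forall>i. \<rho> i = eval_bta M \<rho> (extraction_spec s i)"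
    by (rule unique_solution) (rule guarded_extraction_spec)
  then show ?thesis using assms residual_unfold[of s] by blast
qed

lemma residual_shift: "residual M (\<lambda>i. s (i + d)) = (\<lambda>i. residual M s (i + d))"
  by (rule residual_unique) (metis residual_unfold spec_shift)

lemma residual_Cat: "residual M (iseq (Cat (Prim u) X)) (Suc i) = residual M (iseq X) i"
  using residual_shift[of "iseq (Cat (Prim u) X)" 1] by (simp add: iseq_Cat_Suc)

lemma residual_None: "s i = None \<Longrightarrow> residual M s i = dead M"
  by (subst residual_unfold) (simp add: spec_no_landing lands_None)

lemma residual_Some:
  assumes "s i = Some u"
  shows "residual M s i =
    (case u of
       Basic a \<Rightarrow> post M (residual M s (i + 1)) a (residual M s (i + 1))
     | PosTest a \<Rightarrow> post M (residual M s (i + 1)) a (residual M s (i + 2))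
     | NegTest a \<Rightarrow> post M (residual M s (i + 2)) a (residual M s (i + 1))
     | Jump l \<Rightarrow> residual M s (i + l)
     | Halt \<Rightarrow> stop M)"
proof (cases "\<exists>l. u = Jump l")
  case True
  then obtain l where u: "u = Jump l" by blast
  then have "extraction_spec s i = extraction_spec s (i + l)"
    using assms by (simp add: extraction_spec_def ext[OF lands_jump[of s i l]] cong: if_cong)
  then show ?thesis using u by (metis pga_instr.simps(28) residual_unfold)
next
  case False
  then have "lands s i i" using assms by (simp add: lands_nonjump)
  from spec_landing[OF this] False show ?thesis
    by (subst residual_unfold) (auto simp: assms split: pga_instr.split)
qed

lemma residual_Cat_0:
  fixes X :: "'a pga_instr pterm"
  defines "s \<equiv> \<lambda>u. iseq (Cat (Prim u) X)"
  shows "residual M (s (Basic a)) 0 = post M (residual M (s (Basic a)) 1) a (residual M (s (Basic a)) 1)"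
    "residual M (s (PosTest a)) 0 =
       post M (residual M (s (PosTest a)) 1) a (residual M (s (PosTest a)) 2)"
    "residual M (s (NegTest a)) 0 =
       post M (residual M (s (NegTest a)) 2) a (residual M (s (NegTest a)) 1)"
    "residual M (s (Jump l)) 0 = residual M (s (Jump l)) l"
    "residual M (s Halt) 0 = stop M"
proof -
  have "s u 0 = Some u" for u by (simp add: s_def iseq_Cat_0)
  note unf = residual_Some[of "s u" 0 u for u, OF this]
  show "residual M (s (Basic a)) 0 = post M (residual M (s (Basic a)) 1) a (residual M (s (Basic a)) 1)"
    "residual M (s (PosTest a)) 0 =
       post M (residual M (s (PosTest a)) 1) a (residual M (s (PosTest a)) 2)"
    "residual M (s (NegTest a)) 0 =
       post M (residual M (s (NegTest a)) 2) a (residual M (s (NegTest a)) 1)"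
    "residual M (s (Jump l)) 0 = residual M (s (Jump l)) l"
    "residual M (s Halt) 0 = stop M"
    using unf[of "Basic a"] unf[of "PosTest a"] unf[of "NegTest a"] unf[of "Jump l"] unf[of Halt]
    by (simp_all add: numeral_2_eq_2)
qed

lemma residual_infinite_chain:
  assumes "\<And>n. \<exists>l. s (c n) = Some (Jump l) \<and> c (Suc n) = c n + l"
  shows "residual M s (c 0) = dead M"
  using no_landing[of s c, OF assms] by (subst residual_unfold) (simp add: spec_no_landing)

theorem extraction_equations:
  "thread_of M (Prim (Basic a)) = post M (dead M) a (dead M)"
  "thread_of M (Prim (PosTest a)) = post M (dead M) a (dead M)"
  "thread_of M (Prim (NegTest a)) = post M (dead M) a (dead M)"
  "thread_of M (Cat (Prim (Basic a)) X) = post M (thread_of M X) a (thread_of M X)"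
  "thread_of M (Cat (Prim (PosTest a)) X) =
     post M (thread_of M X) a (thread_of M (Cat (Prim (Jump 2)) X))"
  "thread_of M (Cat (Prim (NegTest a)) X) =
     post M (thread_of M (Cat (Prim (Jump 2)) X)) a (thread_of M X)"
  "thread_of M (Prim (Jump l)) = dead M"
  "thread_of M (Cat (Prim (Jump 0)) X) = dead M"
  "thread_of M (Cat (Prim (Jump 1)) X) = thread_of M X"
  "thread_of M (Cat (Prim (Jump (l + 2))) (Prim u)) = dead M"
  "thread_of M (Cat (Prim (Jump (l + 2))) (Cat (Prim u) X)) = thread_of M (Cat (Prim (Jump (l + 1))) X)"
  "thread_of M (Prim Halt) = stop M"
  "thread_of M (Cat (Prim Halt) X) = stop M"
  "(\<And>n. \<exists>l. iseq X (c n) = Some (Jump l) \<and> c (Suc n) = c n + l) \<Longrightarrow> c 0 = 0 \<Longrightarrow>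
     thread_of M X = dead M"
proof -
  have one: "thread_of M (Prim u) =
      (case u of Basic a \<Rightarrow> post M (dead M) a (dead M) | PosTest a \<Rightarrow> post M (dead M) a (dead M)
         | NegTest a \<Rightarrow> post M (dead M) a (dead M) | Jump l \<Rightarrow> dead M | Halt \<Rightarrow> stop M)" for u
  proof -
    have "iseq (Prim u) 0 = Some u" by (simp add: iseq_Prim)
    note first = residual_Some[of "iseq (Prim u)" 0 u, OF this]
    have later: "residual M (iseq (Prim u)) i = dead M" if "i > 0" for i
      using that by (simp add: residual_None iseq_Prim)
    have "residual M (iseq (Prim (Jump 0))) 0 = dead M"
      using residual_infinite_chain[of "iseq (Prim (Jump 0))" "\<lambda>_. 0"] by (simp add: iseq_Prim)
    then have "residual M (iseq (Prim u)) 0 = dead M" if "u = Jump l" for l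
      using that first later[of l] by (cases "l = 0") auto
    then show ?thesis
      using first later unfolding thread_of_def by (cases u) simp_all
  qed
  have shift: "residual M (iseq (Cat (Prim u) X)) i = residual M (iseq X) (i - 1)" if "i > 0" for u X i
    using that residual_Cat[of u X "i - 1"] by simp
  note unf = residual_Cat_0
  show "thread_of M (Prim (Basic a)) = post M (dead M) a (dead M)"
    "thread_of M (Prim (PosTest a)) = post M (dead M) a (dead M)"
    "thread_of M (Prim (NegTest a)) = post M (dead M) a (dead M)"
    "thread_of M (Prim (Jump l)) = dead M"
    "thread_of M (Prim Halt) = stop M"
    by (simp_all add: one)
  show "thread_of M (Cat (Prim (Basic a)) X) = post M (thread_of M X) a (thread_of M X)"
    "thread_of M (Cat (Prim (PosTest a)) X) =
       post M (thread_of M X) a (thread_of M (Cat (Prim (Jump 2)) X))"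
    "thread_of M (Cat (Prim (NegTest a)) X) =
       post M (thread_of M (Cat (Prim (Jump 2)) X)) a (thread_of M X)"
    "thread_of M (Cat (Prim (Jump 1)) X) = thread_of M X"
    "thread_of M (Cat (Prim (Jump (l + 2))) (Cat (Prim u) X)) =
       thread_of M (Cat (Prim (Jump (l + 1))) X)"
    "thread_of M (Cat (Prim Halt) X) = stop M"
    unfolding thread_of_def by (simp_all add: unf shift)
  show "thread_of M (Cat (Prim (Jump (l + 2))) (Prim u)) = dead M"
    unfolding thread_of_def by (simp add: unf shift residual_None iseq_Prim)
  show chain: "thread_of M X = dead M"
    if "\<And>n. \<exists>l. iseq X (c n) = Some (Jump l) \<and> c (Suc n) = c n + l" "c 0 = 0" for X c
    using residual_infinite_chain[of "iseq X" c, OF that(1)] that(2) by (simp add: thread_of_def)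
  show "thread_of M (Cat (Prim (Jump 0)) X) = dead M"
    by (rule chain[of _ "\<lambda>_. 0"]) (simp_all add: iseq_Cat_0)
qed

end


section \<open>A model\<close>

text \<open>All finite and infinite threads, up to isomorphism the projective limit model.\<close>

codatatype 'a thread = TDead | TStop | TPost "'a thread" 'a "'a thread"

fun tproj :: "nat \<Rightarrow> 'a thread \<Rightarrow> 'a thread" where
  "tproj 0 x = TDead"
| "tproj (Suc n) TDead = TDead"
| "tproj (Suc n) TStop = TStop"
| "tproj (Suc n) (TPost x a y) = TPost (tproj n x) a (tproj n y)"

definition thread_algebra :: "('a, 'a thread) bta_algebra" where
  "thread_algebra = \<lparr>dead = TDead, stop = TStop, post = TPost, proj = tproj\<rparr>"

text \<open>\<open>solve E t\<close> is the value of \<open>t\<close> under the solution of \<open>E\<close>.\<close>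

fun head :: "('v, 'a) bta_term \<Rightarrow> bool + ('v, 'a) bta_term \<times> 'a \<times> ('v, 'a) bta_term" where
  "head (Post l a r) = Inr (l, a, r)"
| "head Stop = Inl True"
| "head _ = Inl False"

fun step :: "('v \<Rightarrow> ('v, 'a) bta_term) \<Rightarrow> ('v, 'a) bta_term
    \<Rightarrow> bool + ('v, 'a) bta_term \<times> 'a \<times> ('v, 'a) bta_term" where
  "step E (Var X) = head (E X)"
| "step E t = head t"

primcorec solve :: "('v \<Rightarrow> ('v, 'a) bta_term) \<Rightarrow> ('v, 'a) bta_term \<Rightarrow> 'a thread" where
  "solve E t =
     (case step E t of
        Inl b \<Rightarrow> if b then TStop else TDead
      | Inr q \<Rightarrow> TPost (solve E (fst q)) (fst (snd q)) (solve E (snd (snd q))))"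

lemma solve_simps:
  "solve E Dead = TDead"
  "solve E Stop = TStop"
  "solve E (Post l a r) = TPost (solve E l) a (solve E r)"
  by (simp_all add: solve.code[of E Dead] solve.code[of E Stop] solve.code[of E "Post l a r"])

lemma tproj_eqI: "(\<And>n. tproj n x = tproj n y) \<Longrightarrow> x = y"
proof (coinduction arbitrary: x y)
  case Eq_thread
  have 1: "tproj (Suc n) x = tproj (Suc n) y" for n using Eq_thread by blast
  show ?case
  proof (cases x)
    case TDead
    then show ?thesis using 1[of 0] by (cases y) auto
  next
    case TStop
    then show ?thesis using 1[of 0] by (cases y) auto
  next
    case x: (TPost x1 a x2)
    then obtain y1 b y2 where y: "y = TPost y1 b y2" using 1[of 0] by (cases y) auto
    have "a = b \<and> (\<forall>n. tproj n x1 = tproj n y1) \<and> (\<forall>n. tproj n x2 = tproj n y2)"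
      using 1 x y by simp
    then show ?thesis using x y by auto
  qed
qed

lemma eval_solve:
  "eval_bta thread_algebra (\<lambda>X. solve E (Var X)) t = solve E t"
  by (induction t) (simp_all add: thread_algebra_def solve_simps)

lemma solve_Var:
  assumes "guarded (E X)"
  shows "solve E (Var X) = solve E (E X)"
  using assms by (cases "E X") (simp_all add: solve_simps solve.code[of E "Var X"])

lemma tproj_Suc_eqD: "tproj (Suc n) x = tproj (Suc n) y \<Longrightarrow> tproj n x = tproj n y"
proof (induction n arbitrary: x y)
  case (Suc n)
  show ?case
  proof (cases x)
    case TDead
    then show ?thesis using Suc.prems by (cases y) auto
  next
    case TStop
    then show ?thesis using Suc.prems by (cases y) auto
  next
    case x: (TPost x1 a x2)
    then obtain y1 b y2 where y: "y = TPost y1 b y2" using Suc.prems by (cases y) auto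
    have "tproj (Suc n) x1 = tproj (Suc n) y1" "a = b" "tproj (Suc n) x2 = tproj (Suc n) y2"
      using Suc.prems x y by simp_all
    then show ?thesis using x y Suc.IH[of x1 y1] Suc.IH[of x2 y2] by simp
  qed
qed simp

lemma eval_tproj:
  assumes "\<And>X. tproj n (\<rho> X) = tproj n (\<rho>' X)"
  shows "tproj n (eval_bta thread_algebra \<rho> t) = tproj n (eval_bta thread_algebra \<rho>' t)"
  using assms
proof (induction t arbitrary: n)
  case (Post s a t)
  show ?case
  proof (cases n)
    case (Suc m)
    have "tproj m (\<rho> X) = tproj m (\<rho>' X)" for X
      by (rule tproj_Suc_eqD) (use Post.prems[of X] Suc in simp)
    then show ?thesis using Post.IH Suc by (simp add: thread_algebra_def)
  qed simp
qed (simp_all add: thread_algebra_def)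

lemma thread_algebra_model: "thread_model (thread_algebra :: ('a, 'a thread) bta_algebra)"
proof
  show "s = t"
    if "vars s = {}" "vars t = {}" "eval_bta thread_algebra \<rho> s = eval_bta thread_algebra \<rho> t"
    for s t :: "(nat, 'a) bta_term" and \<rho>
    using that
  proof (induction s arbitrary: t)
    case (Post s1 a s2)
    then show ?case by (cases t) (auto simp: thread_algebra_def)
  next
    case Dead
    then show ?case by (cases t) (auto simp: thread_algebra_def)
  next
    case Stop
    then show ?case by (cases t) (auto simp: thread_algebra_def)
  qed simp
  show "x = y" if "\<And>n. proj thread_algebra n x = proj thread_algebra n y" for x y :: "'a thread"
    by (rule tproj_eqI) (use that in \<open>simp add: thread_algebra_def\<close>)
  show "\<exists>!\<rho>. \<forall>X. \<rho> X = eval_bta thread_algebra \<rho> (E X)"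
    if g: "\<And>X. guarded (E X)" for E :: "nat \<Rightarrow> (nat, 'a) bta_term"
  proof (rule ex_ex1I)
    show "\<exists>\<rho>. \<forall>X. \<rho> X = eval_bta thread_algebra \<rho> (E X)"
    proof (intro exI allI)
      fix X
      show "solve E (Var X) = eval_bta thread_algebra (\<lambda>X. solve E (Var X)) (E X)"
        unfolding eval_solve by (rule solve_Var) (rule g)
    qed
  next
    fix \<rho> \<rho>' :: "nat \<Rightarrow> 'a thread"
    assume r: "\<forall>X. \<rho> X = eval_bta thread_algebra \<rho> (E X)"
      and r': "\<forall>X. \<rho>' X = eval_bta thread_algebra \<rho>' (E X)"
    have "tproj n (\<rho> X) = tproj n (\<rho>' X)" for n X
    proof (induction n arbitrary: X)
      case (Suc n)
      show ?case
      proof (cases "E X")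
        case (Post s a t)
        then have "\<rho> X = TPost (eval_bta thread_algebra \<rho> s) a (eval_bta thread_algebra \<rho> t)"
          "\<rho>' X = TPost (eval_bta thread_algebra \<rho>' s) a (eval_bta thread_algebra \<rho>' t)"
          using r[rule_format, of X] r'[rule_format, of X] by (simp_all add: thread_algebra_def)
        then show ?thesis using eval_tproj[of n \<rho> \<rho>'] Suc by simp
      next
        case Dead
        then show ?thesis
          using r[rule_format, of X] r'[rule_format, of X] by simp
      next
        case Stop
        then show ?thesis
          using r[rule_format, of X] r'[rule_format, of X] by simp
      next
        case (Var Y)
        then show ?thesis using g[of X] by simp
      qed
    qed simp
    then have "\<rho> X = \<rho>' X" for X by (rule tproj_eqI)
    then show "\<rho> = \<rho>'" by (rule ext)
  qed
qed (simp_all add: thread_algebra_def)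

end

(*
  In the unrolled instruction sequence control only moves forward, and a goto leads to the position
  after the next occurrence of its label. Hence every path that passes a position p enters the part
  of the sequence from p on at one of at most k + 2 positions: p, p + 1 (a test skipping p), and the
  successor of the first lbl(l) from p on, for each l <= k.

  The thread T_0 with T_i = T_i <| a |> T_{i+1} for i < m and T_m = S has m distinct residual
  threads T_i that can be repeated forever. If T_0 is extracted from a sequence, each T_i is the
  residual at some position; repeating it until it passes a common p beyond all these positions
  yields m different entry positions, so m <= k + 2.
*)

theory Submission
  imports Defs
begin

section \<open>Entry positions into the rest of a sequence\<close>

lemma canonical_subset_prims:
  "canonical P = (us, vs) \<Longrightarrow> set us \<union> set vs \<subseteq> prims P"
  by (induction P arbitrary: us vs) (fastforce split: prod.splits if_splits)+

text \<open>Carries the label bound of \<open>pgag_k\<close> from the term to the sequence it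
  denotes.\<close>

lemma iseq_in_prims:
  assumes "iseq P i = Some u"
  shows "u \<in> prims P"
proof -
  obtain us vs where c: "canonical P = (us, vs)" by fastforce
  have "u \<in> set us \<union> set vs"
    using assms by (auto simp: iseq_def c split: if_splits)
  then show ?thesis using canonical_subset_prims[OF c] by blast
qed

text \<open>A label absent from \<open>p\<close> on has \<open>first_label\<close> 0 and so merely
  contributes \<open>p\<close> again.\<close>

definition entries :: "nat \<Rightarrow> (nat \<Rightarrow> 'a pgag_instr) \<Rightarrow> nat \<Rightarrow> nat set" where
  "entries k g p = {p, Suc p} \<union> (\<lambda>l. p + first_label g p l) ` {1..k}"

lemma finite_entries: "finite (entries k g p)"
  by (simp add: entries_def)

lemma card_entries_le: "card (entries k g p) \<le> k + 2"
proof -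
  let ?L = "(\<lambda>l. p + first_label g p l) ` {1..k}"
  have "card (entries k g p) \<le> card {p, Suc p} + card ?L"
    unfolding entries_def by (rule card_Un_le)
  also have "\<dots> \<le> 2 + k" using card_image_le[of "{1..k}"] by fastforce
  finally show ?thesis by simp
qed

text \<open>If the jump from \<open>q\<close> passes \<open>p\<close>, the first label from
  \<open>q\<close> on lies at \<open>p\<close> or later, hence is also the first one from
  \<open>p\<close> on.\<close>

lemma first_label_later:
  assumes "q \<le> p" "p < q + first_label g q l"
  shows "p + first_label g p l = q + first_label g q l"
proof -
  define d where "d = (LEAST d. g (q + d) = Label l)"
  from assms have ex: "\<exists>d. g (q + d) = Label l" by (auto simp: first_label_def split: if_splits)
  then have gd: "g (q + d) = Label l" unfolding d_def by (rule LeastI_ex)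
  have fq: "first_label g q l = Suc d" using ex by (simp add: first_label_def d_def)
  with assms have pd: "p \<le> q + d" by simp
  have at: "g (p + (q + d - p)) = Label l" using gd pd by simp
  have "(LEAST d. g (p + d) = Label l) = q + d - p"
  proof (rule Least_equality)
    show "g (p + (q + d - p)) = Label l" by (rule at)
    fix e
    assume "g (p + e) = Label l"
    then have "g (q + (p - q + e)) = Label l" using assms(1) by simp
    then have "d \<le> p - q + e" unfolding d_def by (rule Least_le)
    then show "q + d - p \<le> e" using assms(1) by simp
  qed
  then have "first_label g p l = Suc (q + d - p)" using at by (auto simp: first_label_def)
  then show ?thesis using fq pd by simp
qed

lemma goto_target_in_entries:
  assumes "\<And>i l. g i = Label l \<Longrightarrow> 1 \<le> l \<and> l \<le> k"
    and "q \<le> p" "p \<le> q + first_label g q l" "first_label g q l \<noteq> 0"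
  shows "q + first_label g q l \<in> entries k g p"
\<comment> \<open>A target equal to \<open>p\<close> has its label at \<open>p - 1\<close>,
  invisible from \<open>p\<close>; it is covered by the entry \<open>p\<close> itself.\<close>
proof (cases "p = q + first_label g q l")
  case False
  with assms have "p + first_label g p l = q + first_label g q l"
    by (intro first_label_later) simp_all
  moreover from assms(4) have "\<exists>d. g (q + d) = Label l"
    by (auto simp: first_label_def split: if_splits)
  with assms(1) have "l \<in> {1..k}" by auto
  ultimately show ?thesis unfolding entries_def by (metis UnI2 imageI)
qed (simp add: entries_def)

section \<open>Residual threads in an arbitrary model\<close>

context thread_model
begin

text \<open>
  A model may contain elements on which \<open>post\<close> is not injective; it is injective on those whose
  projections are all values of closed terms.
\<close>

definition approximable :: "'t \<Rightarrow> bool" where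
  "approximable x \<longleftrightarrow>
     (\<forall>n. \<exists>t :: (nat, 'a) bta_term. vars t = {} \<and> proj M n x = eval_bta M (\<lambda>_. dead M) t)"

text \<open>Each projection of the equation relates values of closed terms, where
  \<open>closed_inj\<close> applies; approximation induction then recovers the components.\<close>

lemma post_inject:
  assumes ap: "approximable x" "approximable y" "approximable x'" "approximable y'"
    and eq: "post M x a y = post M x' b y'"
  shows "x = x'" "a = b" "y = y'"
proof -
  have "proj M n x = proj M n x' \<and> a = b \<and> proj M n y = proj M n y'" for n
  proof -
    obtain s t s' t' :: "(nat, 'a) bta_term"
      where v: "vars s = {}" "vars t = {}" "vars s' = {}" "vars t' = {}"
        and e: "proj M n x = eval_bta M (\<lambda>_. dead M) s" "proj M n y = eval_bta M (\<lambda>_. dead M) t"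
          "proj M n x' = eval_bta M (\<lambda>_. dead M) s'" "proj M n y' = eval_bta M (\<lambda>_. dead M) t'"
      using ap unfolding approximable_def by metis
    have "post M (proj M n x) a (proj M n y) = post M (proj M n x') b (proj M n y')"
      using arg_cong[OF eq, of "proj M (Suc n)"] by (simp add: proj_post)
    then have "Post s a t = Post s' b t'"
      using v e by (intro closed_inj[of _ _ "\<lambda>_. dead M"]) simp_all
    then show ?thesis using e by simp
  qed
  then show "x = x'" "a = b" "y = y'" by (auto intro: approximation_induction)
qed

lemma post_neq_dead: "post M x a y \<noteq> dead M"
proof
  assume "post M x a y = dead M"
  from arg_cong[OF this, of "proj M (Suc 0)"] have "post M (dead M) a (dead M) = dead M"
    by (simp add: proj_post proj_dead proj_0)
  then have "eval_bta M \<rho> (Post Dead a Dead) = eval_bta M \<rho> Dead" for \<rho> :: "nat \<Rightarrow> 't" by simp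
  from closed_inj[OF _ _ this] show False by simp
qed

lemma post_neq_stop: "post M x a y \<noteq> stop M"
proof
  assume "post M x a y = stop M"
  from arg_cong[OF this, of "proj M (Suc 0)"] have "post M (dead M) a (dead M) = stop M"
    by (simp add: proj_post proj_stop proj_0)
  then have "eval_bta M \<rho> (Post Dead a Dead) = eval_bta M \<rho> Stop" for \<rho> :: "nat \<Rightarrow> 't" by simp
  from closed_inj[OF _ _ this] show False by simp
qed

lemma residual_cases:
  obtains "residual M s i = dead M"
  | "residual M s i = stop M"
  | j a j' where "residual M s i = post M (residual M s j) a (residual M s j')"
proof -
  have "residual M s i = dead M \<or> residual M s i = stop M \<or>
    (\<exists>j a j'. residual M s i = post M (residual M s j) a (residual M s j'))"
    by (subst (1 2 3) residual_unfold)
      (auto simp: extraction_spec_def Let_def split: option.split pga_instr.split)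
  then show thesis using that by blast
qed

text \<open>A projection unfolds the guarded specification only finitely often, and cutting off
  there leaves a closed term. Thus \<open>post_inject\<close> applies to residuals.\<close>

lemma approximable_residual: "approximable (residual M s i)"
  unfolding approximable_def
proof
  fix n
  show "\<exists>t :: (nat, 'a) bta_term. vars t = {} \<and>
      proj M n (residual M s i) = eval_bta M (\<lambda>_. dead M) t"
  proof (induction n arbitrary: i)
    case 0
    show ?case by (intro exI[of _ Dead]) (simp add: proj_0)
  next
    case (Suc n)
    show ?case
    proof (cases rule: residual_cases[of s i])
      case 1
      then show ?thesis by (intro exI[of _ Dead]) (simp add: proj_dead)
    next
      case 2
      then show ?thesis by (intro exI[of _ Stop]) (simp add: proj_stop)
    next
      case (3 j a j')
      obtain t t' :: "(nat, 'a) bta_term" where "vars t = {}" "vars t' = {}"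
        "proj M n (residual M s j) = eval_bta M (\<lambda>_. dead M) t"
        "proj M n (residual M s j') = eval_bta M (\<lambda>_. dead M) t'"
        using Suc by metis
      with 3 show ?thesis by (intro exI[of _ "Post t a t'"]) (simp add: proj_post)
    qed
  qed
qed

text \<open>Serves the step from \<open>T i\<close> to \<open>T (Suc i)\<close>: unfolding a
  residual yields residuals as branches, and \<open>post_inject\<close> identifies them.\<close>

lemma residual_right:
  assumes "residual M s i = post M x a y" "approximable x" "approximable y"
  obtains j where "residual M s j = y"
proof (cases rule: residual_cases[of s i])
  case 1
  with assms(1) show ?thesis by (metis post_neq_dead)
next
  case 2
  with assms(1) show ?thesis by (metis post_neq_stop)
next
  case (3 j b j')
  then have "residual M s j' = y"
    using assms post_inject(3)[of "residual M s j" "residual M s j'" x y b a]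
    by (simp add: approximable_residual)
  then show ?thesis by (rule that)
qed

text \<open>As \<open>x\<close> is its own left branch, always following reply T keeps the residual
  \<open>x\<close>, while the position strictly increases until it reaches or passes
  \<open>p\<close>.\<close>

lemma residual_at_entry:
  assumes s: "\<And>i. s i = Some (translate (first_label g i) (g i))"
    and labels: "\<And>i l. g i = Label l \<Longrightarrow> 1 \<le> l \<and> l \<le> k"
    and x: "x = post M x a y" "approximable x" "approximable y"
  shows "residual M s q = x \<Longrightarrow> q < p \<Longrightarrow> \<exists>e \<in> entries k g p. residual M s e = x"
proof (induction "p - q" arbitrary: q rule: less_induct)
  case less
  note unf = residual_Some[of s q, OF s]
  \<comment> \<open>One move suffices: below \<open>p\<close> the induction hypothesis takes over,
    otherwise the move itself enters at \<open>q'\<close>.\<close>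
  have here: ?case
    if "residual M s q' = x" "q < q'" "p \<le> q' \<Longrightarrow> q' \<in> entries k g p" for q'
  proof (cases "q' < p")
    case True
    then show ?thesis using that less.prems by (intro less.hyps[of q']) simp_all
  next
    case False
    then show ?thesis using that by auto
  qed
  have near: "Suc q \<in> entries k g p" if "p \<le> Suc q"
    using that less.prems(2) by (simp add: entries_def le_antisym Suc_le_eq)
  \<comment> \<open>A negative test skips one instruction on reply T, so it may enter at
    \<open>Suc p\<close>.\<close>
  have near2: "Suc (Suc q) \<in> entries k g p" if "p \<le> Suc (Suc q)"
  proof -
    have "p = Suc q \<or> p = Suc (Suc q)" using that less.prems(2) by linarith
    then show ?thesis by (auto simp: entries_def)
  qed
  have left: "residual M s j = x" if "residual M s q = post M (residual M s j) b (residual M s j')"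
    for j b j'
  proof (rule post_inject(1)[OF approximable_residual approximable_residual x(2,3)])
    show "post M (residual M s j) b (residual M s j') = post M x a y"
      using that less.prems(1) x(1) by metis
  qed
  have live: "residual M s q \<noteq> dead M" "residual M s q \<noteq> stop M"
    using less.prems(1) x(1) post_neq_dead post_neq_stop by metis+
  show ?case
  proof (cases "g q")
    case (GBasic b)
    then have "residual M s (Suc q) = x" using unf by (intro left) simp
    then show ?thesis using near by (intro here[of "Suc q"]) simp_all
  next
    case (GPosTest b)
    then have "residual M s (Suc q) = x" using unf by (intro left) simp
    then show ?thesis using near by (intro here[of "Suc q"]) simp_all
  next
    case (GNegTest b)
    then have "residual M s (Suc (Suc q)) = x" using unf by (intro left) simp
    then show ?thesis using near2 by (intro here[of "Suc (Suc q)"]) simp_all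
  next
    case (Label l)
    then have "residual M s (Suc q) = x" using unf less.prems(1) by simp
    then show ?thesis using near by (intro here[of "Suc q"]) simp_all
  next
    case (Goto l)
    \<comment> \<open>A missing label is translated to \<open>Jump 0\<close>, an infinite chain,
      hence deadlock; but \<open>x\<close> is a \<open>post\<close>.\<close>
    have "first_label g q l \<noteq> 0"
    proof
      assume "first_label g q l = 0"
      then have "residual M s q = dead M"
        using residual_infinite_chain[of s "\<lambda>_. q"] s[of q] Goto by simp
      with live(1) show False ..
    qed
    moreover have "residual M s (q + first_label g q l) = x"
      using unf Goto less.prems(1) by simp
    ultimately show ?thesis
      using less.prems(2) goto_target_in_entries[where g = g, OF labels]
      by (intro here[of "q + first_label g q l"]) simp_all
  next
    case GHalt
    then show ?thesis using unf live(2) by simp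
  qed
qed

lemma repeatable_residuals_le:
  assumes s: "\<And>i. s i = Some (translate (first_label g i) (g i))"
    and labels: "\<And>i l. g i = Label l \<Longrightarrow> 1 \<le> l \<and> l \<le> k"
    and T: "\<And>i. i < m \<Longrightarrow> T i = post M (T i) a (T (Suc i))" "\<And>i. approximable (T i)"
    and inj: "inj_on T {..<m}"
    and start: "residual M s 0 = T 0"
  shows "m \<le> k + 2"
proof -
  have "i < m \<Longrightarrow> \<exists>q. residual M s q = T i" for i
  proof (induction i)
    case 0
    show ?case using start by blast
  next
    case (Suc i)
    then obtain q where "residual M s q = T i" by auto
    then have "residual M s q = post M (T i) a (T (Suc i))" using T(1)[of i] Suc.prems by simp
    then show ?case using T(2) residual_right by metis
  qed
  then obtain q where q: "\<And>i. i < m \<Longrightarrow> residual M s (q i) = T i" by metis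
  \<comment> \<open>One position beyond all \<open>q i\<close>, so that every \<open>T i\<close> is
    pushed across the same boundary.\<close>
  define p where "p = Suc (\<Sum>i<m. q i)"
  have below: "q i < p" if "i < m" for i
    using that member_le_sum[of i "{..<m}" q] by (simp add: p_def less_Suc_eq_le)
  have "\<exists>e \<in> entries k g p. residual M s e = T i" if "i < m" for i
    by (rule residual_at_entry[OF s labels T(1)[OF that] T(2) T(2) q[OF that]])
      (simp_all add: below that)
  then obtain e where e: "\<And>i. i < m \<Longrightarrow> e i \<in> entries k g p \<and> residual M s (e i) = T i"
    by metis
  \<comment> \<open>One position has one residual, so distinct \<open>T i\<close> need distinct
    entries.\<close>
  then have "inj_on e {..<m}" using inj by (metis inj_on_def lessThan_iff)
  moreover have "e ` {..<m} \<subseteq> entries k g p" using e by auto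
  ultimately have "card {..<m} \<le> card (entries k g p)"
    by (intro card_inj_on_le[of e] finite_entries)
  then show ?thesis using card_entries_le[of k g p] by simp
qed

end

section \<open>The staircase thread as a PGA term\<close>

text \<open>The sequence is +a; #2m taken \<open>m\<close> times, then !, all repeated. Reply T
  reaches the jump, leading to the same test one period later; reply F skips it to the next test or
  to \<open>Halt\<close>.\<close>

definition staircase :: "'a \<Rightarrow> nat \<Rightarrow> 'a pga_instr pterm" where
  "staircase a m = pterm_of_lasso []
     (map (\<lambda>j. if j = 2 * m then Halt else if even j then PosTest a else Jump (2 * m))
        [0..<Suc (2 * m)])"

lemma iseq_staircase:
  "iseq (staircase a m) i =
     (let j = i mod Suc (2 * m) in
      Some (if j = 2 * m then Halt else if even j then PosTest a else Jump (2 * m)))"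
proof -
  define B where
    "B = map (\<lambda>j. if j = 2 * m then Halt else if even j then PosTest a else Jump (2 * m))
       [0..<Suc (2 * m)]"
  have "B \<noteq> []" by (simp add: B_def)
  then have "canonical (staircase a m) = ([], B)"
    unfolding staircase_def B_def[symmetric] by (rule canonical_pterm_of_lasso)
  then have "iseq (staircase a m) i = Some (B ! (i mod Suc (2 * m)))"
    using \<open>B \<noteq> []\<close> by (simp add: iseq_def B_def del: upt_Suc)
  also have "B ! (i mod Suc (2 * m)) =
      (let j = i mod Suc (2 * m) in
       if j = 2 * m then Halt else if even j then PosTest a else Jump (2 * m))"
    unfolding B_def Let_def by (subst nth_map) (simp_all del: upt_Suc)
  finally show ?thesis by (simp add: Let_def)
qed

context thread_model
begin

lemma staircase_residual_step:
  fixes a :: 'a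
  assumes "i < m"
  defines "T \<equiv> \<lambda>i. residual M (iseq (staircase a m)) (2 * i)"
  shows "T i = post M (T i) a (T (Suc i))"
proof -
  let ?s = "iseq (staircase a m)"
  have test: "?s (2 * i) = Some (PosTest a)"
    using assms(1) by (simp add: iseq_staircase Let_def)
  have loop: "?s (Suc (2 * i)) = Some (Jump (2 * m))"
  proof -
    have "Suc (2 * i) \<noteq> 2 * m" by presburger
    then show ?thesis using assms(1) by (simp add: iseq_staircase Let_def)
  qed
  \<comment> \<open>The jump at \<open>2 * i + 1\<close> covers \<open>2 * m\<close>, so it lands
    exactly one period after \<open>2 * i\<close>.\<close>
  have "(\<lambda>i. ?s (i + Suc (2 * m))) = ?s"
    by (simp add: fun_eq_iff iseq_staircase Let_def del: add_Suc_right)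
  then have "residual M ?s (2 * i + Suc (2 * m)) = residual M ?s (2 * i)"
    using residual_shift[of ?s "Suc (2 * m)"] by (metis (no_types))
  then have "residual M ?s (Suc (2 * i)) = residual M ?s (2 * i)"
    using residual_Some[of ?s, OF loop] by simp
  then show ?thesis using residual_Some[of ?s, OF test] by (simp add: T_def)
qed

lemma staircase_residual_end: "residual M (iseq (staircase a m)) (2 * m) = stop M"
proof -
  have "iseq (staircase a m) (2 * m) = Some Halt" by (simp add: iseq_staircase)
  from residual_Some[of "iseq (staircase a m)", OF this] show ?thesis by simp
qed

text \<open>Equal residuals have equal right branches; stepping both forward would equate
  \<open>stop M\<close> with an earlier residual, which is a \<open>post\<close>.\<close>

lemma inj_on_staircase_residual:
  "inj_on (\<lambda>i. residual M (iseq (staircase a m)) (2 * i)) {..<m}"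
proof -
  define T where "T i = residual M (iseq (staircase a m)) (2 * i)" for i
  have step: "T i = post M (T i) a (T (Suc i))" if "i < m" for i
    unfolding T_def using that by (rule staircase_residual_step)
  have "T m = stop M" unfolding T_def by (rule staircase_residual_end)
  then have "i < j \<Longrightarrow> j \<le> m \<Longrightarrow> T i \<noteq> T j" for i j
  proof (induction "m - j" arbitrary: i j)
    case 0
    then have "i < m" "j = m" by simp_all
    then show ?case using 0 step[of i] post_neq_stop by metis
  next
    case (Suc n)
    then have "T (Suc i) \<noteq> T (Suc j)" by simp
    moreover have "T i = post M (T i) a (T (Suc i))" "T j = post M (T j) a (T (Suc j))"
      using Suc by (intro step; simp)+
    moreover have "approximable (T i)" for i
      unfolding T_def by (rule approximable_residual)
    ultimately show ?case by (metis post_inject(3))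
  qed
  then have "inj_on T {..<m}" by (intro linorder_inj_onI) auto
  then show ?thesis by (simp add: T_def[abs_def])
qed

end

theorem corollary3:
  fixes M :: "('a, 't) bta_algebra"
  assumes "thread_model M"
  shows "\<forall>k. \<exists>P :: 'a pga_instr pterm.
           \<not> (\<exists>P' :: 'a pgag_instr pterm. pgag_k k P' \<and> thread_of M P = thread_of M (pgag2pga P'))"
proof (intro allI exI notI)
  interpret thread_model M by fact
  fix k
  define a where "a = (undefined :: 'a)"
  \<comment> \<open>\<open>k + 3\<close> steps give one more repeatable residual than the bound
    \<open>k + 2\<close> allows.\<close>
  define T where "T i = residual M (iseq (staircase a (k + 3))) (2 * i)" for i
  assume "\<exists>P'. pgag_k k P' \<and> thread_of M (staircase a (k + 3)) = thread_of M (pgag2pga P')"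
  then obtain P' where k: "pgag_k k P'"
    and eq: "thread_of M (staircase a (k + 3)) = thread_of M (pgag2pga P')" by blast
  \<comment> \<open>A finite sequence is continued with \<open>Goto 1\<close> as in
    \<open>pgag2pga\<close>; this adds no label.\<close>
  define g where "g i = (case iseq P' i of Some u \<Rightarrow> u | None \<Rightarrow> Goto 1)" for i
  have "k + 3 \<le> k + 2"
  proof (rule repeatable_residuals_le)
    show "iseq (pgag2pga P') i = Some (translate (first_label g i) (g i))" for i
      by (simp add: iseq_pgag2pga g_def[abs_def])
    show "1 \<le> l \<and> l \<le> k" if "g i = Label l" for i l
    proof -
      have "Label l \<in> prims P'"
        using that by (intro iseq_in_prims[of P' i]) (simp add: g_def split: option.splits)
      then show ?thesis using k by (simp add: pgag_k_def)
    qed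
    show "T i = post M (T i) a (T (Suc i))" if "i < k + 3" for i
      unfolding T_def using that by (rule staircase_residual_step)
    show "approximable (T i)" for i unfolding T_def by (rule approximable_residual)
    show "inj_on T {..<k + 3}"
      unfolding T_def[abs_def] by (rule inj_on_staircase_residual)
    show "residual M (iseq (pgag2pga P')) 0 = T 0"
      using eq by (simp add: T_def thread_of_def)
  qed
  then show False by simp
qed

end
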